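(* For every game with activeness $G^g$ there exists a unique canonical game $H^h$ with $G^g=H^h$.
   Context: Let $\mathcal{B}=\{0,1\}$. Define $\mathbb{I}_0=\{\emptyset\}\times\mathcal{B}$ and $\mathbb{I}_n=2^{\mathbb{I}_{n-1}}\times\mathcal{B}$ for $n\ge1$; a game with activeness is an element of $\mathbb{I}=\bigcup_{n\ge0}\mathbb{I}_n$ (uniqueness is as elements of $\mathbb{I}$). A pair $(G,g)$ is written $G^g$; the elements of $G$ are the options of $G^g$, $g=1$ meaning active. The outcome $o$ is defined recursively: $o(G^g)=\mathscr{N}$ if $g=1$ and some option has outcome $\mathscr{P}$, and $o(G^g)=\mathscr{P}$ otherwise. The sum is $G^g+H^h=(\{G'^{g'}+H^h:G'^{g'}\in G^g\}\cup\{G^g+H'^{h'}:H'^{h'}\in H^h\})^{\max\{g,h\}}$. $G^g=H^h$ means $o(G^g+X^x)=o(H^h+X^x)$ for all games $X^x$. An option $G'^{g'}$ of $G^g$ is reversible if there is an option $G''^{g''}\in G'^{g'}$ with $G''^{g''}=G^g$. A game is canonical (defined recursively) if every option of it is canonical and no option of it is reversible. *)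

theory Defs
  imports "HOL-Library.FSet"
begin

text \<open>Every level \<open>I\<^sub>n\<close> is finite, so the elements of the union of the levels are exactly the
  hereditarily finite pairs of a set of options and an activeness flag (\<open>True\<close> for \<open>1\<close>). The lemmas
  about \<open>level\<close> below confirm that the datatype is this union.\<close>

datatype game = Game (opts: "game fset") (active: bool)

primrec level :: "nat \<Rightarrow> game set" where
  "level 0 = {G. opts G = {||}}"
| "level (Suc n) = {G. fset (opts G) \<subseteq> level n}"

lemma level_0_eq: "level 0 = Game {||} ` UNIV"
  by (auto simp: image_iff) (metis game.collapse)

lemma level_Suc_eq: "level (Suc n) = (\<lambda>(S, b). Game (Abs_fset S) b) ` (Pow (level n) \<times> UNIV)"
  if "finite (level n)"
proof (intro set_eqI iffI)
  fix G assume "G \<in> level (Suc n)"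
  then have "G = (\<lambda>(S, b). Game (Abs_fset S) b) (fset (opts G), active G)"
    "(fset (opts G), active G) \<in> Pow (level n) \<times> UNIV"
    by (auto simp: fset_inverse)
  then show "G \<in> (\<lambda>(S, b). Game (Abs_fset S) b) ` (Pow (level n) \<times> UNIV)"
    by (rule image_eqI)
next
  fix G assume "G \<in> (\<lambda>(S, b). Game (Abs_fset S) b) ` (Pow (level n) \<times> UNIV)"
  then obtain S b where "S \<subseteq> level n" "G = Game (Abs_fset S) b" by auto
  moreover from this that have "fset (Abs_fset S) = S"
    by (simp add: Abs_fset_inverse finite_subset)
  ultimately show "G \<in> level (Suc n)" by simp
qed

lemma finite_level: "finite (level n)"
  by (induction n) (simp_all only: level_0_eq level_Suc_eq finite_imageI finite
      finite_cartesian_product finite_Pow_iff)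

lemma level_Suc_mono: "level n \<subseteq> level (Suc n)"
  by (induction n) auto

lemma level_mono: "m \<le> n \<Longrightarrow> level m \<subseteq> level n"
  by (rule lift_Suc_mono_le[of level]) (rule level_Suc_mono)

lemma Union_level: "(\<Union>n. level n) = UNIV"
proof -
  have "\<exists>n. G \<in> level n" for G
  proof (induction G)
    case (Game A b)
    then obtain f where f: "\<And>G. G \<in> fset A \<Longrightarrow> G \<in> level (f G)" by metis
    have "G \<in> level (Max (f ` fset A))" if "G \<in> fset A" for G
      using f[OF that] level_mono[of "f G" "Max (f ` fset A)"] that by auto
    then have "Game A b \<in> level (Suc (Max (f ` fset A)))" by auto
    then show ?case ..
  qed
  then show ?thesis by auto
qed

lemma size_option: "G' |\<in>| opts G \<Longrightarrow> size G' < size G"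
  by (cases G)
    (auto simp: less_Suc_eq_le intro: order.trans[OF _ member_le_sum[of G' _ "\<lambda>x. Suc (size x)"]])

declare fimage_cong [fundef_cong]

datatype outcome_class = N_position | P_position

function outcome :: "game \<Rightarrow> outcome_class" where
  "outcome G =
    (if active G \<and> (\<exists>G' |\<in>| opts G. outcome G' = P_position) then N_position else P_position)"
  by auto
termination
  by (relation "measure size") (auto intro: size_option)

declare outcome.simps [simp del]

function gsum :: "game \<Rightarrow> game \<Rightarrow> game" where
  "gsum G H =
    Game ((\<lambda>G'. gsum G' H) |`| opts G |\<union>| (\<lambda>H'. gsum G H') |`| opts H) (max (active G) (active H))"
  by auto
termination
  by (relation "measure (\<lambda>(G, H). size G + size H)") (auto intro: size_option)

declare gsum.simps [simp del]

definition game_eq :: "game \<Rightarrow> game \<Rightarrow> bool" (infix \<open>\<doteq>\<close> 50) where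
  "G \<doteq> H \<longleftrightarrow> (\<forall>X. outcome (gsum G X) = outcome (gsum H X))"

definition reversible :: "game \<Rightarrow> game \<Rightarrow> bool" where
  "reversible G G' \<longleftrightarrow> G' |\<in>| opts G \<and> (\<exists>G'' |\<in>| opts G'. G'' \<doteq> G)"

function canonical :: "game \<Rightarrow> bool" where
  "canonical G \<longleftrightarrow>
    (\<forall>G' |\<in>| opts G. canonical G') \<and> (\<forall>G' |\<in>| opts G. \<not> reversible G G')"
  by auto
termination
  by (relation "measure size") (auto intro: size_option)

declare canonical.simps [simp del]

end

theory Submission
  imports Defs
begin

text \<open>If \<open>A \<noteq> B\<close>, then some active \<open>T\<close> makes \<open>A + T\<close> a \<open>P\<close>-position and \<open>B + T\<close> an
  \<open>N\<close>-position, in whichever order \<open>A\<close> and \<open>B\<close> are taken. Collecting such \<open>T\<close>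
  as options of one active game shows, as in the theory of misere games, that if no option of
  either of two games equals the other game, then a single active \<open>T\<close> makes both sums
  \<open>P\<close>-positions. Applied to a non-reversible option of \<open>G\<close> and to a game \<open>K = G\<close>, this forces
  that option to equal some option of \<open>K\<close>; uniqueness follows by induction. For existence, a
  game of least size in its class is canonical: a reversible option would
  give a smaller equal game, and options may be replaced by equal ones.\<close>

section \<open>Outcomes of sums, and mirroring play\<close>

lemma not_P_position_iff: "c \<noteq> P_position \<longleftrightarrow> c = N_position"
  by (cases c) auto

lemma outcome_eq_P_iff:
  "outcome G = P_position \<longleftrightarrow> (active G \<longrightarrow> (\<forall>G' |\<in>| opts G. outcome G' = N_position))"
  by (subst outcome.simps) (simp flip: not_P_position_iff)

lemma outcome_eq_N_iff:
  "outcome G = N_position \<longleftrightarrow> active G \<and> (\<exists>G' |\<in>| opts G. outcome G' = P_position)"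
  by (subst outcome.simps) auto

lemma active_gsum [simp]: "active (gsum G H) \<longleftrightarrow> active G \<or> active H"
  by (subst gsum.simps) (auto simp: max_def)

lemma opts_gsum:
  "opts (gsum G H) = (\<lambda>G'. gsum G' H) |`| opts G |\<union>| (\<lambda>H'. gsum G H') |`| opts H"
  by (subst gsum.simps) simp

lemma outcome_gsum_P_iff:
  "outcome (gsum G X) = P_position \<longleftrightarrow>
    (active G \<or> active X \<longrightarrow>
      (\<forall>G' |\<in>| opts G. outcome (gsum G' X) = N_position) \<and>
      (\<forall>X' |\<in>| opts X. outcome (gsum G X') = N_position))"
  by (subst outcome_eq_P_iff) (auto simp: opts_gsum)

lemma outcome_gsum_N_iff:
  "outcome (gsum G X) = N_position \<longleftrightarrow>
    (active G \<or> active X) \<and>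
      ((\<exists>G' |\<in>| opts G. outcome (gsum G' X) = P_position) \<or>
       (\<exists>X' |\<in>| opts X. outcome (gsum G X') = P_position))"
  by (subst outcome_eq_N_iff) (auto simp: opts_gsum)

lemma outcome_gsum_N_leftI:
  "\<lbrakk>G' |\<in>| opts G; outcome (gsum G' X) = P_position; active G \<or> active X\<rbrakk>
    \<Longrightarrow> outcome (gsum G X) = N_position"
  by (subst outcome_gsum_N_iff) blast

lemma outcome_gsum_N_rightI:
  "\<lbrakk>X' |\<in>| opts X; outcome (gsum G X') = P_position; active G \<or> active X\<rbrakk>
    \<Longrightarrow> outcome (gsum G X) = N_position"
  by (subst outcome_gsum_N_iff) blast

lemma game_eq_refl: "G \<doteq> G"
  by (simp add: game_eq_def)

lemma game_eq_sym: "G \<doteq> H \<Longrightarrow> H \<doteq> G"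
  by (simp add: game_eq_def)

lemma game_eq_trans: "G \<doteq> H \<Longrightarrow> H \<doteq> K \<Longrightarrow> G \<doteq> K"
  by (simp add: game_eq_def)

text \<open>A substitute for the negative of a game. All flags are set so that a mirroring reply is
  never blocked by inactivity.\<close>

primrec mate :: "game \<Rightarrow> game" where
  "mate (Game A b) = Game (mate |`| A) True"

lemma active_mate [simp]: "active (mate G)"
  by (cases G) simp

lemma opts_mate [simp]: "opts (mate G) = mate |`| opts G"
  by (cases G) simp

text \<open>The second player copies each move in the other component; one component is always a
  mate, so the sum is active when the reply is made.\<close>

lemma outcome_gsum_mate: "outcome (gsum G (mate G)) = P_position"
proof (induction G rule: measure_induct_rule[of size])
  case (less G)
  have "outcome (gsum G' (mate G)) = N_position" if "G' |\<in>| opts G" for G'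
    using that by (intro outcome_gsum_N_rightI[of "mate G'"] less.IH) (auto intro: size_option)
  moreover have "outcome (gsum G (mate G')) = N_position" if "G' |\<in>| opts G" for G'
    using that by (intro outcome_gsum_N_leftI[of G'] less.IH) (auto intro: size_option)
  ultimately show ?case
    by (subst outcome_gsum_P_iff) auto
qed

lemma game_eq_imp_active:
  assumes "G \<doteq> H" "active G"
  shows "active H"
proof (rule ccontr)
  assume "\<not> active H"
  \<comment> \<open>\<open>X\<close> must be inactive: then \<open>gsum H X\<close> is inactive,
    hence a P-position at once, while the active \<open>gsum G X\<close> has the winning move to
    \<open>gsum G (mate G)\<close>.\<close>
  define X where "X = Game {|mate G|} False"
  have "outcome (gsum G X) = N_position"
    using assms(2) by (intro outcome_gsum_N_rightI[of "mate G"])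
      (auto simp: X_def outcome_gsum_mate)
  moreover have "outcome (gsum H X) = P_position"
    using \<open>\<not> active H\<close> by (subst outcome_gsum_P_iff) (simp add: X_def)
  ultimately show False
    using assms(1) by (simp add: game_eq_def)
qed

section \<open>Active games that separate unequal games\<close>

lemma distinguisher_swap:
  assumes "outcome (gsum A T) = N_position" "outcome (gsum B T) = P_position"
  obtains U where "active U"
    "outcome (gsum A U) = P_position" "outcome (gsum B U) = N_position"
proof
  \<comment> \<open>The option \<open>T\<close> is the winning move from \<open>gsum B ?U\<close>.
    The mates answer every move inside \<open>A\<close>, and the move to \<open>gsum A T\<close>
    loses by assumption.\<close>
  let ?U = "Game (finsert T (mate |`| opts A)) True"
  show "active ?U" by simp
  show "outcome (gsum B ?U) = N_position"
    using assms(2) by (intro outcome_gsum_N_rightI[of T]) auto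
  have "outcome (gsum A' ?U) = N_position" if "A' |\<in>| opts A" for A'
    using that by (intro outcome_gsum_N_rightI[of "mate A'"]) (auto simp: outcome_gsum_mate)
  moreover have "outcome (gsum A (mate A')) = N_position" if "A' |\<in>| opts A" for A'
    using that by (intro outcome_gsum_N_leftI[of A']) (auto simp: outcome_gsum_mate)
  ultimately show "outcome (gsum A ?U) = P_position"
    using assms(1) by (subst outcome_gsum_P_iff) auto
qed

lemma not_game_eq_distinguisher:
  assumes "\<not> A \<doteq> B"
  obtains T where "active T"
    "outcome (gsum A T) = P_position" "outcome (gsum B T) = N_position"
proof -
  obtain X where X: "outcome (gsum A X) \<noteq> outcome (gsum B X)"
    using assms by (auto simp: game_eq_def)
  show thesis
  proof (cases "outcome (gsum A X)")
    case N_position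
    with X have "outcome (gsum B X) = P_position"
      by (cases "outcome (gsum B X)") auto
    with N_position show thesis
      using distinguisher_swap that by blast
  next
    case P_position
    with X have "outcome (gsum B X) = N_position"
      by (cases "outcome (gsum B X)") auto
    \<comment> \<open>\<open>X\<close> already has the required outcomes but may be inactive;
      swapping twice restores the orientation with an active game.\<close>
    with P_position obtain U where
      "outcome (gsum B U) = P_position" "outcome (gsum A U) = N_position"
      using distinguisher_swap by blast
    then show thesis
      using distinguisher_swap that by blast
  qed
qed

lemma linked:
  assumes A: "\<And>A'. A' |\<in>| opts A \<Longrightarrow> \<not> A' \<doteq> B"
    and B: "\<And>B'. B' |\<in>| opts B \<Longrightarrow> \<not> B' \<doteq> A"
  obtains T where "active T"
    "outcome (gsum A T) = P_position" "outcome (gsum B T) = P_position"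
proof -
  have "\<exists>T. active T \<and> outcome (gsum A' T) = P_position \<and> outcome (gsum B T) = N_position"
    if "A' |\<in>| opts A" for A'
    using not_game_eq_distinguisher[OF A[OF that]] by blast
  then obtain f where f: "\<And>A'. A' |\<in>| opts A \<Longrightarrow> active (f A')"
    "\<And>A'. A' |\<in>| opts A \<Longrightarrow> outcome (gsum A' (f A')) = P_position"
    "\<And>A'. A' |\<in>| opts A \<Longrightarrow> outcome (gsum B (f A')) = N_position"
    by metis
  have "\<exists>T. active T \<and> outcome (gsum B' T) = P_position \<and> outcome (gsum A T) = N_position"
    if "B' |\<in>| opts B" for B'
    using not_game_eq_distinguisher[OF B[OF that]] by blast
  then obtain g where g: "\<And>B'. B' |\<in>| opts B \<Longrightarrow> active (g B')"
    "\<And>B'. B' |\<in>| opts B \<Longrightarrow> outcome (gsum B' (g B')) = P_position"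
    "\<And>B'. B' |\<in>| opts B \<Longrightarrow> outcome (gsum A (g B')) = N_position"
    by metis
  \<comment> \<open>After a move to \<open>gsum A' ?T\<close> or \<open>gsum A (f A')\<close>, the
    reply \<open>gsum A' (f A')\<close> wins; activeness of \<open>f A'\<close> makes the second
    reply possible. A move to \<open>gsum A (g B')\<close> loses by the choice of \<open>g\<close>.
    The same holds with \<open>A\<close> and \<open>B\<close> exchanged.\<close>
  let ?T = "Game (f |`| opts A |\<union>| g |`| opts B) True"
  have "outcome (gsum A' ?T) = N_position" "outcome (gsum A (f A')) = N_position"
    if "A' |\<in>| opts A" for A'
    using that f by (auto intro: outcome_gsum_N_rightI[of "f A'"] outcome_gsum_N_leftI[of A'])
  moreover have "outcome (gsum B' ?T) = N_position" "outcome (gsum B (g B')) = N_position"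
    if "B' |\<in>| opts B" for B'
    using that g by (auto intro: outcome_gsum_N_rightI[of "g B'"] outcome_gsum_N_leftI[of B'])
  ultimately have "outcome (gsum A ?T) = P_position" "outcome (gsum B ?T) = P_position"
    using f(3) g(3) by (subst outcome_gsum_P_iff, auto)+
  then show thesis
    by (intro that[of ?T]) auto
qed

section \<open>Uniqueness of canonical games\<close>

lemma game_eq_option:
  assumes "G \<doteq> K" "G' |\<in>| opts G" "\<not> reversible G G'"
  shows "\<exists>K' |\<in>| opts K. G' \<doteq> K'"
proof (rule ccontr)
  assume *: "\<not> ?thesis"
  \<comment> \<open>Non-reversibility excludes \<open>G'' \<doteq> G\<close>, and
    \<open>G \<doteq> K\<close> carries this over to \<open>K\<close>.\<close>
  have "\<not> G'' \<doteq> K" if "G'' |\<in>| opts G'" for G''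
    using that assms game_eq_trans game_eq_sym unfolding reversible_def by blast
  moreover have "\<not> K' \<doteq> G'" if "K' |\<in>| opts K" for K'
    using that * game_eq_sym by blast
  ultimately obtain T where T: "active T"
    "outcome (gsum G' T) = P_position" "outcome (gsum K T) = P_position"
    using linked[of G' K] by blast
  have "outcome (gsum G T) = N_position"
    using T assms(2) by (blast intro: outcome_gsum_N_leftI)
  then show False
    using T(3) assms(1) by (simp add: game_eq_def)
qed

lemma canonical_unique:
  assumes "canonical G" "canonical K" "G \<doteq> K"
  shows "G = K"
  using assms
proof (induction G arbitrary: K rule: measure_induct_rule[of size])
  case (less G)
  have G: "canonical G'" "\<not> reversible G G'" if "G' |\<in>| opts G" for G'
    using less.prems(1) that by (subst (asm) canonical.simps, blast)+
  have K: "canonical K'" "\<not> reversible K K'" if "K' |\<in>| opts K" for K'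
    using less.prems(2) that by (subst (asm) canonical.simps, blast)+
  have opt_eq: "G' = K'" if "G' |\<in>| opts G" "K' |\<in>| opts K" "G' \<doteq> K'" for G' K'
    using that G K by (intro less.IH size_option)
  have "G' |\<in>| opts K" if "G' |\<in>| opts G" for G'
    using game_eq_option[OF less.prems(3) that G(2)[OF that]] opt_eq that by blast
  moreover have "K' |\<in>| opts G" if "K' |\<in>| opts K" for K'
    using game_eq_option[OF game_eq_sym[OF less.prems(3)] that K(2)[OF that]]
      opt_eq that game_eq_sym by blast
  ultimately have "opts G = opts K"
    by blast
  moreover have "active G = active K"
    using game_eq_imp_active less.prems(3) game_eq_sym by blast
  ultimately show ?case
    by (rule game.expand[OF conjI])
qed

section \<open>Existence through games of least size\<close>

lemma game_eq_cong:
  assumes act: "active G = active K"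
    and GK: "\<And>G'. G' |\<in>| opts G \<Longrightarrow> \<exists>K' |\<in>| opts K. G' \<doteq> K'"
    and KG: "\<And>K'. K' |\<in>| opts K \<Longrightarrow> \<exists>G' |\<in>| opts G. G' \<doteq> K'"
  shows "G \<doteq> K"
  unfolding game_eq_def
proof
  fix X
  show "outcome (gsum G X) = outcome (gsum K X)"
  \<comment> \<open>Induction on \<open>X\<close> alone suffices: moves in \<open>G\<close> and
    \<open>K\<close> lead to equal games, whose outcomes with the same \<open>X\<close> agree by
    definition.\<close>
  proof (induction X rule: measure_induct_rule[of size])
    case (less X)
    have X: "outcome (gsum G X') = outcome (gsum K X')" if "X' |\<in>| opts X" for X'
      using that by (intro less.IH size_option)
    have opt: "outcome (gsum G' X) = P_position \<longleftrightarrow> outcome (gsum K' X) = P_position"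
      if "G' \<doteq> K'" for G' K'
      using that by (simp add: game_eq_def)
    have options: "(\<exists>G' |\<in>| opts G. outcome (gsum G' X) = P_position) \<longleftrightarrow>
        (\<exists>K' |\<in>| opts K. outcome (gsum K' X) = P_position)"
      using GK KG opt by blast
    have "outcome (gsum G X) = N_position \<longleftrightarrow> outcome (gsum K X) = N_position"
      unfolding outcome_gsum_N_iff[of G X] outcome_gsum_N_iff[of K X]
      using act X options by simp
    then show ?case
      using not_P_position_iff by metis
  qed
qed

lemma size_replace_option:
  assumes "H' |\<in>| opts H" "size K < size H'"
  shows "size (Game (finsert K (opts H |-| {|H'|})) b) < size H"
proof -
  let ?f = "\<lambda>x::game. Suc (size x)"
  \<comment> \<open>Only an inequality, since \<open>K\<close> may already be among the remaining
    options.\<close>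
  have "sum ?f (insert K (fset (opts H) - {H'})) \<le> ?f K + sum ?f (fset (opts H) - {H'})"
    by (simp add: sum.insert_if)
  also have "\<dots> < ?f H' + sum ?f (fset (opts H) - {H'})"
    using assms(2) by simp
  also have "\<dots> = sum ?f (fset (opts H))"
    using assms(1) by (simp add: sum.remove[of _ H'])
  finally show ?thesis
    by (cases H) simp
qed

lemma game_eq_replace_option:
  assumes "H' |\<in>| opts H" "H' \<doteq> K"
  shows "H \<doteq> Game (finsert K (opts H |-| {|H'|})) (active H)"
  using assms by (intro game_eq_cong) (auto intro: game_eq_refl)

lemma least_size_imp_canonical:
  assumes "\<And>K. H \<doteq> K \<Longrightarrow> size H \<le> size K"
  shows "canonical H"
  using assms
proof (induction H rule: measure_induct_rule[of size])
  case (less H)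
  \<comment> \<open>Least size passes to options: a smaller game equal to \<open>H'\<close>, put in
    its place, would yield a smaller game equal to \<open>H\<close>.\<close>
  have "canonical H'" if H': "H' |\<in>| opts H" for H'
  proof (rule less.IH[OF size_option[OF H']])
    fix K assume "H' \<doteq> K"
    then show "size H' \<le> size K"
      using less.prems[OF game_eq_replace_option[OF H']] size_replace_option[OF H']
      by (metis not_le)
  qed
  moreover have "\<not> reversible H H'" if H': "H' |\<in>| opts H" for H'
  proof
    assume "reversible H H'"
    then obtain H'' where "H'' |\<in>| opts H'" "H'' \<doteq> H"
      by (auto simp: reversible_def)
    then show False
      using less.prems[OF game_eq_sym] size_option[of H'' H'] size_option[OF H'] by fastforce
  qed
  ultimately show ?case
    by (subst canonical.simps) blast
qed

theorem theorem3p37: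
  fixes G :: game
  shows "\<exists>!H. canonical H \<and> G \<doteq> H"
proof (rule ex_ex1I)
  obtain H where "G \<doteq> H" and H: "\<And>K. G \<doteq> K \<Longrightarrow> size H \<le> size K"
    using arg_min_nat_lemma[of "\<lambda>H. G \<doteq> H" G size] game_eq_refl by blast
  then have "canonical H"
    by (blast intro: least_size_imp_canonical game_eq_trans)
  with \<open>G \<doteq> H\<close> show "\<exists>H. canonical H \<and> G \<doteq> H"
    by blast
next
  fix H K
  assume "canonical H \<and> G \<doteq> H" "canonical K \<and> G \<doteq> K"
  then show "H = K"
    using canonical_unique game_eq_sym game_eq_trans by blast
qed

end
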